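(* Let $T$ be a linear operator associated with a compact Calderón–Zygmund kernel $K$ on $\mathbb R^n$ with parameter $0<\delta<1$ and auxiliary functions $L,S,D$. Let $\phi_I$ be a bump function adapted to and supported on a cube $I$ with constant $C>0$, decay $N$ and order zero. Then, in $\mathbb R^n\setminus 5I$, $T(\phi_I)$ satisfies the estimates of a bump function adapted to $I$ with constant a multiple of $C$, decay $n$, order one and parameter $\delta$, with an extra decay factor; precisely, $$ |T(\phi_I)(x)|\lesssim C|I|^{-\frac12}\,w_I(x)^{-n}\,F_K(\langle I,x\rangle) $$ for all $x\notin5I$, and $$ |T(\phi_I)(x)-T(\phi_I)(x')|\lesssim C\,\frac{|x-x'|_\infty^{\delta}}{\ell(I)^{\delta}}\,|I|^{-\frac12}\,w_I\Big(\frac{x+x'}{2}\Big)^{-(n+\delta)}L(\ell(\langle I,x\rangle))\,S(|x-x'|_\infty)\,D(\mathrm{rdist}(\langle I,x\rangle,\mathbb B)) $$ for all $x,x'\in\mathbb R^n$ such that $x\notin5I$, $|x-x'|_\infty<\ell(I)/2$ and $\langle x,x'\rangle\cap5I=\emptyset$. The implicit constants are independent of $\phi_I$, $I$, $x$, $x'$ and $C$.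
   Context: **Cubes.** A cube is $I=\prod_{i=1}^n[a_i,b_i]$ with all $b_i-a_i>0$ equal; $c(I)$ is its centre, $\ell(I)$ its side length, $|I|=\ell(I)^n$; $\lambda I$ is the cube with the same centre and side $\lambda\ell(I)$. $|\cdot|_\infty$ is the max norm on $\mathbb R^n$, $\mathbb B=[-1/2,1/2]^n$. $\langle I,J\rangle$ is the cube containing $I\cup J$ with smallest possible side length and whose centre has smallest possible first coordinate (any fixed choice if this is not unique); the notation is also used with points, regarded as degenerate cubes ($\langle I,x\rangle$, $\langle x,x'\rangle$). Put $\mathrm{rdist}(I,J)=\ell(\langle I,J\rangle)/\max(\ell(I),\ell(J))$ and $w_I(x)=1+\ell(I)^{-1}|x-c(I)|_\infty$. **Bump function** ($L^2$-normalized): a bounded (measurable) $\phi$ is a bump function adapted to $I$ with constant $C$, decay $N\in\mathbb N$ and order zero if $|\phi(x)|\le C|I|^{-1/2}\big(1+\frac{|x-c(I)|_\infty}{\ell(I)}\big)^{-N}$ for all $x\in\mathbb R^n$. **Kernel.** $K$ is defined on $\{(t,x)\in\mathbb R^n\times\mathbb R^n: t\ne x\}$ with values in $\mathbb C$. $L,S,D:[0,\infty)\to[0,\infty)$ are bounded, $L,D$ non-increasing, $S$ non-decreasing, with $\lim_{y\to\infty}L(y)=\lim_{y\to0}S(y)=\lim_{y\to\infty}D(y)=0$. That $K$ is a compact Calderón–Zygmund kernel with parameter $\delta$ and functions $L,S,D$ means (this is the working form of the definition): for some constant $C_K>0$, $$|K(t,x)-K(t',x')|\le C_K\frac{(|t-t'|_\infty+|x-x'|_\infty)^{\delta}}{|t-x|_\infty^{n+\delta}}\,L(|t-x|_\infty)\,S(|t-t'|_\infty+|x-x'|_\infty)\,D\Big(1+\frac{|t+x|_\infty}{1+|t-x|_\infty}\Big)$$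 whenever $2(|t-t'|_\infty+|x-x'|_\infty)<|t-x|_\infty$, and $$|K(t,x)|\le C_K\frac{1}{|t-x|_\infty^{n}}\,L(|t-x|_\infty)\,S(|t-x|_\infty)\,D\Big(1+\frac{|t+x|_\infty}{1+|t-x|_\infty}\Big)\quad (t\neq x).$$ **Function $F_K$.** For a cube $Q$, $F_K(Q)=L(\ell(Q))\,S(\ell(Q))\,D(\mathrm{rdist}(Q,\mathbb B))$. **Convention on constants.** Universal constants inside the arguments of $L,S,D$ are omitted: the estimates are understood to hold after replacing $L,S,D$ on their right-hand sides by $L(\kappa\,\cdot),S(\kappa^{-1}\cdot),D(\kappa\,\cdot)$ for some constant $\kappa\in(0,1]$ depending only on $n$ and $\delta$. **Operator.** $T:\mathcal C_0(\mathbb R^n)\to\mathcal C_0(\mathbb R^n)'$ is continuous and linear ($\mathcal C_0(\mathbb R^n)$: continuous functions with compact support), and is associated with $K$: $\langle T(f),g\rangle=\iint f(t)g(x)K(x,t)\,dt\,dx$ whenever $f,g$ have disjoint compact supports; this formula is also used to define the pairing for $f$ integrable with compact support and $g\in\mathcal C_0(\mathbb R^n)$ with support disjoint from that of $f$. No boundedness, weak compactness or cancellation hypotheses are assumed on $T$. **Pointwise values.** Let $\Phi\in\mathcal S(\mathbb R^n)$ be non-negative, supported on $\mathbb B$, with $\int\Phi=1$, and $\Phi_{x,\epsilon}(y)=\epsilon^{-n}\Phi(\epsilon^{-1}(y-x))$. For $f$ integrable supported in a cube $I$ and $x\notin3I$, $T(f)(x)=\lim_{\epsilon\to0}\langle T(f),\Phi_{x,\epsilon}\rangle$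 (the limit exists). *)

theory Defs
  imports "HOL-Analysis.Analysis"
begin

section \<open>Cubes\<close>

definition cube :: "real^'n \<Rightarrow> real \<Rightarrow> (real^'n) set" where
  "cube c l = cbox (\<chi> i. c $ i - l / 2) (\<chi> i. c $ i + l / 2)"

definition is_cube :: "(real^'n) set \<Rightarrow> bool" where
  "is_cube Q \<longleftrightarrow> (\<exists>c l. l > 0 \<and> Q = cube c l)"

text \<open>Points count as cubes of side length 0.\<close>

definition is_cube_or_point :: "(real^'n) set \<Rightarrow> bool" where
  "is_cube_or_point Q \<longleftrightarrow> (\<exists>c l. l \<ge> 0 \<and> Q = cube c l)"

definition centre :: "(real^'n) set \<Rightarrow> real^'n" where
  "centre Q = (THE c. \<exists>l\<ge>0. Q = cube c l)"

definition side :: "(real^'n) set \<Rightarrow> real" where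
  "side Q = (THE l. l \<ge> 0 \<and> (\<exists>c. Q = cube c l))"

lemma cube_eq_iff:
  fixes c c' :: "real^'n"
  assumes "l \<ge> 0" "l' \<ge> 0"
  shows "cube c l = cube c' l' \<longleftrightarrow> c = c' \<and> l = l'"
proof
  assume eq: "cube c l = cube c' l'"
  have ne: "cube c l \<noteq> {}"
    using assms by (auto simp: cube_def interval_ne_empty_cart)
  with eq have a: "(\<chi> i. c $ i - l / 2) = (\<chi> i. c' $ i - l' / 2)"
    and b: "(\<chi> i. c $ i + l / 2) = (\<chi> i. c' $ i + l' / 2)"
    by (auto simp: cube_def eq_cbox)
  have *: "c $ i - l / 2 = c' $ i - l' / 2 \<and> c $ i + l / 2 = c' $ i + l' / 2" for i
    using a b by (simp add: vec_eq_iff)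
  have "c $ i = c' $ i" "l = l'" for i
    using *[of i] by auto
  then show "c = c' \<and> l = l'"
    by (simp add: vec_eq_iff)
qed simp

lemma centre_cube: "l \<ge> 0 \<Longrightarrow> centre (cube c l) = c"
  unfolding centre_def by (rule the_equality) (auto simp: cube_eq_iff)

lemma side_cube: "l \<ge> 0 \<Longrightarrow> side (cube c l) = l"
  unfolding side_def by (rule the_equality) (auto simp: cube_eq_iff)

definition vol :: "(real^'n) set \<Rightarrow> real" where
  "vol Q = side Q ^ CARD('n)"

definition dilate :: "real \<Rightarrow> (real^'n) set \<Rightarrow> (real^'n) set" where
  "dilate r Q = cube (centre Q) (r * side Q)"

definition unit_cube :: "(real^'n) set" where
  "unit_cube = cube 0 1"

text \<open>
  The coordinates of \<^typ>\<open>real^'n\<close> are not ordered, so the coordinate that serves as the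
  first one is an explicit parameter \<open>i\<close>. Remaining ties are broken by the choice operator.
\<close>

definition smallest_cube :: "'n \<Rightarrow> (real^'n) set \<Rightarrow> (real^'n) set \<Rightarrow> bool" where
  "smallest_cube i A Q \<longleftrightarrow>
     is_cube_or_point Q \<and> A \<subseteq> Q \<and>
     (\<forall>Q'. is_cube_or_point Q' \<and> A \<subseteq> Q' \<longrightarrow> side Q \<le> side Q') \<and>
     (\<forall>Q'. is_cube_or_point Q' \<and> A \<subseteq> Q' \<and> side Q' = side Q \<longrightarrow> centre Q $ i \<le> centre Q' $ i)"

definition joint_cube :: "'n \<Rightarrow> (real^'n) set \<Rightarrow> (real^'n) set \<Rightarrow> (real^'n) set" where
  "joint_cube i A B = (SOME Q. smallest_cube i (A \<union> B) Q)"

definition rdist :: "'n \<Rightarrow> (real^'n) set \<Rightarrow> (real^'n) set \<Rightarrow> real" where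
  "rdist i Q R = side (joint_cube i Q R) / max (side Q) (side R)"

definition weight :: "(real^'n) set \<Rightarrow> real^'n \<Rightarrow> real" where
  "weight Q x = 1 + infnorm (x - centre Q) / side Q"

section \<open>Bump functions and test functions\<close>

definition vanishes_outside :: "('a \<Rightarrow> 'b::zero) \<Rightarrow> 'a set \<Rightarrow> bool" where
  "vanishes_outside f A \<longleftrightarrow> (\<forall>x. x \<notin> A \<longrightarrow> f x = 0)"

definition bump_order_zero ::
  "(real^'n) set \<Rightarrow> real \<Rightarrow> nat \<Rightarrow> (real^'n \<Rightarrow> complex) \<Rightarrow> bool" where
  "bump_order_zero Q C N f \<longleftrightarrow>
     f \<in> borel_measurable lebesgue \<and> bounded (range f) \<and>
     (\<forall>x. norm (f x) \<le> C * vol Q powr (-1/2)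
            * (1 + infnorm (x - centre Q) / side Q) powr (- real N))"

definition supp :: "('a::topological_space \<Rightarrow> 'b::zero) \<Rightarrow> 'a set" where
  "supp f = closure {x. f x \<noteq> 0}"

definition Cc :: "(real^'n \<Rightarrow> complex) set" where
  "Cc = {f. continuous_on UNIV f \<and> compact (supp f)}"

definition partial :: "'n \<Rightarrow> (real^'n \<Rightarrow> real) \<Rightarrow> real^'n \<Rightarrow> real" where
  "partial i f x = frechet_derivative f (at x) (axis i 1)"

definition iter_partial :: "'n list \<Rightarrow> (real^'n \<Rightarrow> real) \<Rightarrow> real^'n \<Rightarrow> real" where
  "iter_partial is f = foldr partial is f"

definition schwartz :: "(real^'n \<Rightarrow> real) \<Rightarrow> bool" where
  "schwartz f \<longleftrightarrow>
     (\<forall>is. (\<forall>x. iter_partial is f differentiable (at x)) \<and>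
           (\<forall>k::nat. bounded (range (\<lambda>x. norm x ^ k * iter_partial is f x))))"

definition mollifier :: "(real^'n \<Rightarrow> real) \<Rightarrow> bool" where
  "mollifier \<Phi> \<longleftrightarrow>
     schwartz \<Phi> \<and> (\<forall>x. \<Phi> x \<ge> 0) \<and> vanishes_outside \<Phi> unit_cube \<and>
     integral\<^sup>L lebesgue \<Phi> = 1"

definition rescaled :: "(real^'n \<Rightarrow> real) \<Rightarrow> real^'n \<Rightarrow> real \<Rightarrow> real^'n \<Rightarrow> complex" where
  "rescaled \<Phi> x e y = complex_of_real (\<Phi> ((y - x) /\<^sub>R e) / e ^ CARD('n))"

section \<open>Compact Calderon--Zygmund kernels\<close>

definition admissible :: "(real \<Rightarrow> real) \<Rightarrow> (real \<Rightarrow> real) \<Rightarrow> (real \<Rightarrow> real) \<Rightarrow> bool" where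
  "admissible L S D \<longleftrightarrow>
     (\<forall>y\<ge>0. L y \<ge> 0 \<and> S y \<ge> 0 \<and> D y \<ge> 0) \<and>
     bounded (L ` {0..}) \<and> bounded (S ` {0..}) \<and> bounded (D ` {0..}) \<and>
     antimono_on {0..} L \<and> mono_on {0..} S \<and> antimono_on {0..} D \<and>
     (L \<longlongrightarrow> 0) at_top \<and> (S \<longlongrightarrow> 0) (at_right 0) \<and> (D \<longlongrightarrow> 0) at_top"

text \<open>The values of \<open>K\<close> on the diagonal are never constrained and play no role.\<close>

definition compact_CZ_kernel ::
  "real \<Rightarrow> (real \<Rightarrow> real) \<Rightarrow> (real \<Rightarrow> real) \<Rightarrow> (real \<Rightarrow> real)
     \<Rightarrow> (real^'n \<Rightarrow> real^'n \<Rightarrow> complex) \<Rightarrow> bool" where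
  "compact_CZ_kernel \<delta> L S D K \<longleftrightarrow>
     admissible L S D \<and>
     (\<exists>CK>0.
        (\<forall>t x t' x'. 2 * (infnorm (t - t') + infnorm (x - x')) < infnorm (t - x) \<longrightarrow>
           norm (K t x - K t' x')
             \<le> CK * ((infnorm (t - t') + infnorm (x - x')) powr \<delta>
                       / infnorm (t - x) powr (real CARD('n) + \<delta>))
                 * L (infnorm (t - x)) * S (infnorm (t - t') + infnorm (x - x'))
                 * D (1 + infnorm (t + x) / (1 + infnorm (t - x)))) \<and>
        (\<forall>t x. t \<noteq> x \<longrightarrow>
           norm (K t x)
             \<le> CK * (1 / infnorm (t - x) ^ CARD('n))
                 * L (infnorm (t - x)) * S (infnorm (t - x))
                 * D (1 + infnorm (t + x) / (1 + infnorm (t - x)))))"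

definition F_fun ::
  "'n \<Rightarrow> (real \<Rightarrow> real) \<Rightarrow> (real \<Rightarrow> real) \<Rightarrow> (real \<Rightarrow> real) \<Rightarrow> (real^'n) set \<Rightarrow> real" where
  "F_fun i L S D Q = L (side Q) * S (side Q) * D (rdist i Q unit_cube)"

section \<open>Operators\<close>

text \<open>
  An operator from \<^term>\<open>Cc\<close> into its dual is given by its bilinear pairing
  \<open>T f g\<close>, standing for \<open>\<langle>T(f), g\<rangle>\<close>. A linear functional on \<^term>\<open>Cc\<close> (with its inductive
  limit topology) is continuous iff on the functions supported in any fixed compact set
  it is bounded by a multiple of the supremum norm.
\<close>

definition cont_linear_functional :: "((real^'n \<Rightarrow> complex) \<Rightarrow> complex) \<Rightarrow> bool" where
  "cont_linear_functional \<Lambda> \<longleftrightarrow>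
     (\<forall>f\<in>Cc. \<forall>g\<in>Cc. \<forall>a b. \<Lambda> (\<lambda>x. a * f x + b * g x) = a * \<Lambda> f + b * \<Lambda> g) \<and>
     (\<forall>A. compact A \<longrightarrow>
        (\<exists>M. \<forall>f\<in>Cc. supp f \<subseteq> A \<longrightarrow> norm (\<Lambda> f) \<le> M * (SUP x. norm (f x))))"

text \<open>The dual carries the topology of pointwise convergence.\<close>

definition cont_linear_operator ::
  "((real^'n \<Rightarrow> complex) \<Rightarrow> (real^'n \<Rightarrow> complex) \<Rightarrow> complex) \<Rightarrow> bool" where
  "cont_linear_operator T \<longleftrightarrow>
     (\<forall>f\<in>Cc. cont_linear_functional (T f)) \<and>
     (\<forall>g\<in>Cc. cont_linear_functional (\<lambda>f. T f g))"

definition kernel_pairing ::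
  "(real^'n \<Rightarrow> real^'n \<Rightarrow> complex) \<Rightarrow> (real^'n \<Rightarrow> complex) \<Rightarrow> (real^'n \<Rightarrow> complex) \<Rightarrow> complex" where
  "kernel_pairing K f g = (LINT x|lebesgue. (LINT t|lebesgue. f t * g x * K x t))"

definition associated_with ::
  "((real^'n \<Rightarrow> complex) \<Rightarrow> (real^'n \<Rightarrow> complex) \<Rightarrow> complex)
     \<Rightarrow> (real^'n \<Rightarrow> real^'n \<Rightarrow> complex) \<Rightarrow> bool" where
  "associated_with T K \<longleftrightarrow>
     (\<forall>f\<in>Cc. \<forall>g\<in>Cc. supp f \<inter> supp g = {} \<longrightarrow> T f g = kernel_pairing K f g)"

text \<open>
  For \<open>f\<close> not in \<^term>\<open>Cc\<close> the kernel formula defines the pairing; it is only meaningful for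
  \<open>f\<close> integrable with compact support disjoint from that of \<open>g\<close>.
\<close>

definition ext_pairing ::
  "((real^'n \<Rightarrow> complex) \<Rightarrow> (real^'n \<Rightarrow> complex) \<Rightarrow> complex)
     \<Rightarrow> (real^'n \<Rightarrow> real^'n \<Rightarrow> complex)
     \<Rightarrow> (real^'n \<Rightarrow> complex) \<Rightarrow> (real^'n \<Rightarrow> complex) \<Rightarrow> complex" where
  "ext_pairing T K f g = (if f \<in> Cc \<and> g \<in> Cc then T f g else kernel_pairing K f g)"

definition point_value ::
  "((real^'n \<Rightarrow> complex) \<Rightarrow> (real^'n \<Rightarrow> complex) \<Rightarrow> complex)
     \<Rightarrow> (real^'n \<Rightarrow> real^'n \<Rightarrow> complex) \<Rightarrow> (real^'n \<Rightarrow> real)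
     \<Rightarrow> (real^'n \<Rightarrow> complex) \<Rightarrow> real^'n \<Rightarrow> complex" where
  "point_value T K \<Phi> f x = Lim (at_right 0) (\<lambda>e. ext_pairing T K f (rescaled \<Phi> x e))"

end

theory Submission
  imports Defs
begin

text \<open>
  Off \<open>5I\<close> the pointwise value of \<open>T(\<phi>)\<close> is the kernel integral \<open>\<integral> \<phi>(t) K(x,t) dt\<close>, because that
  integral is locally Hoelder continuous in \<open>x\<close> and the mollifiers are an approximate identity. Both
  estimates then follow by bounding the integrand: for \<open>t \<in> I\<close> and \<open>x \<notin> 5I\<close> one has
  \<open>|x - t| \<ge> 4/5 |x - c(I)| \<ge> 2/5 \<ell>(\<langle>I,x\<rangle>)\<close>, \<open>|x - t| \<le> \<ell>(\<langle>I,x\<rangle>)\<close> and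
  \<open>rdist(\<langle>I,x\<rangle>, B) \<le> 4 (1 + |x + t| / (1 + |x - t|))\<close>, so the monotonicity of \<open>L\<close>, \<open>S\<close>, \<open>D\<close> gives
  the result with \<open>\<kappa> = 1/4\<close>.
\<close>

section \<open>Max norm and cubes\<close>

lemma infnorm_le_iff_cart:
  fixes x :: "real^'n"
  shows "infnorm x \<le> a \<longleftrightarrow> (\<forall>i. \<bar>x $ i\<bar> \<le> a)"
proof -
  have *: "{\<bar>x \<bullet> b\<bar> |b. b \<in> Basis} = range (\<lambda>i. \<bar>x $ i\<bar>)"
    by (auto simp: Basis_vec_def inner_axis image_iff) (metis inner_axis real_inner_1_right)
  show ?thesis
    unfolding infnorm_def * by (subst cSup_le_iff) auto
qed

lemma mem_cube_iff: "x \<in> cube c l \<longleftrightarrow> infnorm (x - c) \<le> l / 2"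
proof -
  have "c $ i - l / 2 \<le> x $ i \<and> x $ i \<le> c $ i + l / 2 \<longleftrightarrow> \<bar>(x - c) $ i\<bar> \<le> l / 2" for i
    unfolding vector_minus_component by linarith
  then show ?thesis
    by (simp only: cube_def mem_box_cart infnorm_le_iff_cart vec_lambda_beta)
qed

lemma compact_cube: "compact (cube c l)"
  by (simp add: cube_def compact_cbox)

lemma measure_cube:
  fixes c :: "real^'n"
  assumes "l \<ge> 0"
  shows "measure lebesgue (cube c l) = l ^ CARD('n)"
proof -
  have "cbox (\<chi> i. c $ i - l / 2) (\<chi> i. c $ i + l / 2) \<noteq> {}"
    using assms by (simp add: interval_ne_empty_cart)
  then show ?thesis
    by (simp add: cube_def content_cbox_cart)
qed

lemma dilate_cube: "l \<ge> 0 \<Longrightarrow> dilate r (cube c l) = cube c (r * l)"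
  by (simp add: dilate_def side_cube centre_cube)

lemma infnorm_diff_le_side:
  assumes "is_cube_or_point Q" "x \<in> Q" "y \<in> Q"
  shows "infnorm (x - y) \<le> side Q"
proof -
  obtain c l where Q: "l \<ge> 0" "Q = cube c l"
    using assms(1) by (auto simp: is_cube_or_point_def)
  have "infnorm (x - y) = infnorm ((x - c) + (c - y))" by simp
  also have "\<dots> \<le> infnorm (x - c) + infnorm (y - c)"
    by (metis infnorm_triangle infnorm_sub)
  finally show ?thesis
    using Q assms(2,3) by (simp add: side_cube mem_cube_iff)
qed

section \<open>Smallest enclosing cubes and relative distance to the unit cube\<close>

lemma smallest_cube_exists:
  fixes A :: "(real^'n) set"
  assumes "bounded A" "A \<noteq> {}"
  shows "\<exists>Q. smallest_cube i A Q"
proof -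
  \<comment> \<open>The side is the largest coordinate width of \<open>A\<close>, and pushing every centre coordinate down to
    \<open>b j - l / 2\<close> is the extreme choice for all coordinates at once.\<close>
  define a b where "a j = Inf ((\<lambda>x. x $ j) ` A)" and "b j = Sup ((\<lambda>x. x $ j) ` A)" for j
  define l where "l = Max (range (\<lambda>j. b j - a j))"
  define c :: "real^'n" where "c = (\<chi> j. b j - l / 2)"
  have bdd: "bdd_below ((\<lambda>x. x $ j) ` A)" "bdd_above ((\<lambda>x. x $ j) ` A)" for j
    using bounded_component_cart[OF assms(1)] 
    by (auto intro: bounded_imp_bdd_below bounded_imp_bdd_above)
  have a: "a j \<le> x $ j" and b: "x $ j \<le> b j" if "x \<in> A" for x j
    using that bdd by (auto simp: a_def b_def intro: cInf_lower cSup_upper)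
  have l: "b j - a j \<le> l" for j
    by (simp add: l_def)
  have l0: "l \<ge> 0"
    using assms(2) a b l[of i] by (meson all_not_in_conv diff_ge_0_iff_ge order_trans)
  have sub: "A \<subseteq> cube c l"
  proof
    fix x assume "x \<in> A"
    then have "\<bar>x $ j - c $ j\<bar> \<le> l / 2" for j
      using a[of x j] b[of x j] l[of j] by (simp add: c_def abs_le_iff field_simps)
    then show "x \<in> cube c l"
      unfolding mem_cube_iff infnorm_le_iff_cart by simp
  qed
  have ends: "b j \<le> c' $ j + l' / 2" "c' $ j - l' / 2 \<le> a j" if "A \<subseteq> cube c' l'" for c' l' j
  proof -
    have "x $ j \<le> c' $ j + l' / 2 \<and> c' $ j - l' / 2 \<le> x $ j" if "x \<in> A" for x
    proof -
      have "\<bar>(x - c') $ j\<bar> \<le> l' / 2"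
        using \<open>A \<subseteq> cube c' l'\<close> that unfolding mem_cube_iff infnorm_le_iff_cart subset_iff by blast
      then show ?thesis
        unfolding vector_minus_component by linarith
    qed
    then show "b j \<le> c' $ j + l' / 2" "c' $ j - l' / 2 \<le> a j"
      using assms(2) unfolding a_def b_def by (auto intro!: cSup_least cInf_greatest)
  qed
  have min: "l \<le> l'" if "A \<subseteq> cube c' l'" for c' l'
  proof -
    have "b j - a j \<le> l'" for j using ends[OF that, of j] by linarith
    then show ?thesis by (simp add: l_def)
  qed
  have first: "c $ i \<le> c' $ i" if "A \<subseteq> cube c' l" for c'
    using ends(1)[OF that, of i] by (simp add: c_def)
  have "smallest_cube i A (cube c l)"
    unfolding smallest_cube_def is_cube_or_point_def
    using l0 sub min first by (auto simp: side_cube centre_cube)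
  then show ?thesis ..
qed

text \<open>\<open>joint_cube\<close> is a value of the choice operator, so facts about it become
  available only through the existence of some smallest cube.\<close>

lemma joint_cube_smallest:
  assumes "bounded A" "bounded B" "A \<union> B \<noteq> {}"
  shows "smallest_cube i (A \<union> B) (joint_cube i A B)"
  unfolding joint_cube_def
  by (rule someI_ex, rule smallest_cube_exists) (use assms in auto)

lemma
  assumes "bounded A" "bounded B" "A \<union> B \<noteq> {}"
  shows is_cube_or_point_joint_cube: "is_cube_or_point (joint_cube i A B)"
    and joint_cube_superset: "A \<subseteq> joint_cube i A B" "B \<subseteq> joint_cube i A B"
    and side_joint_cube_le: "l \<ge> 0 \<Longrightarrow> A \<union> B \<subseteq> cube c l \<Longrightarrow> side (joint_cube i A B) \<le> l"
  using joint_cube_smallest[OF assms, of i] unfolding smallest_cube_def is_cube_or_point_def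
  by (auto simp: side_cube) (metis side_cube)

text \<open>Links the geometric quantity \<open>rdist\<close> to the argument of \<open>D\<close> in
  the kernel bounds. Both cubes lie in a cube about 0 whose side is controlled by |x| and
  \<open>side Q\<close>; writing 2x = (x + t) + (x - t) trades |x| for |x + t|, since |x - t| is at
  most \<open>side Q\<close>.\<close>

lemma rdist_unit_cube_le:
  fixes x t :: "real^'n"
  assumes Q: "is_cube_or_point Q" "x \<in> Q" "t \<in> Q"
  shows "0 \<le> rdist i Q unit_cube"
    and "rdist i Q unit_cube \<le> 4 * (1 + infnorm (x + t) / (1 + infnorm (x - t)))"
proof -
  define s where "s = side Q"
  obtain c l where cl: "l \<ge> 0" "Q = cube c l"
    using Q(1) by (auto simp: is_cube_or_point_def)
  have s: "s \<ge> 0" using cl by (simp add: s_def side_cube)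
  have bd: "bounded Q" "bounded (unit_cube :: (real^'n) set)" "Q \<union> unit_cube \<noteq> {}"
    using Q cl by (auto simp: unit_cube_def compact_cube compact_imp_bounded)
  have unit: "side (unit_cube :: (real^'n) set) = 1"
    by (simp add: unit_cube_def side_cube)
  have rd: "rdist i Q unit_cube = side (joint_cube i Q unit_cube) / max s 1"
    by (simp add: rdist_def unit s_def)
  have "infnorm (x - x) \<le> side (joint_cube i Q unit_cube)"
    using infnorm_diff_le_side[OF is_cube_or_point_joint_cube[OF bd]] joint_cube_superset[OF bd] Q
    by blast
  then show "0 \<le> rdist i Q unit_cube"
    using s by (simp add: rd infnorm_0)
  \<comment> \<open>Half of this side is 1/2 + |x| + s: the unit cube needs 1/2, and every point of
    \<open>Q\<close> is within s of x.\<close>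
  have "Q \<union> unit_cube \<subseteq> cube 0 (1 + 2 * infnorm x + 2 * s)"
  proof
    fix y assume "y \<in> Q \<union> unit_cube"
    then show "y \<in> cube 0 (1 + 2 * infnorm x + 2 * s)"
    proof
      assume "y \<in> Q"
      then have "infnorm (y - x) \<le> s"
        using infnorm_diff_le_side Q s_def by blast
      then show ?thesis
        using absdiff_infnorm[of y x] by (simp add: mem_cube_iff)
    next
      assume "y \<in> unit_cube"
      then show ?thesis
        using s by (simp add: mem_cube_iff unit_cube_def infnorm_pos_le add_increasing2)
    qed
  qed
  then have J: "side (joint_cube i Q unit_cube) \<le> 1 + 2 * infnorm x + 2 * s"
    using s by (intro side_joint_cube_le[OF bd]) (auto simp: infnorm_pos_le)
  define p d where "p = infnorm (x + t)" and "d = infnorm (x - t)"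
  have pd: "0 \<le> p" "0 \<le> d" "d \<le> s"
    using infnorm_diff_le_side[OF Q] by (auto simp: p_def d_def s_def infnorm_pos_le)
  have "(x + t) + (x - t) = 2 *\<^sub>R x"
    by (simp add: scaleR_2)
  then have "2 * infnorm x = infnorm ((x + t) + (x - t))"
    by (simp add: infnorm_mul)
  also have "\<dots> \<le> p + d"
    unfolding p_def d_def by (rule infnorm_triangle)
  finally have "side (joint_cube i Q unit_cube) \<le> 4 * max s 1 + p"
    using J pd by linarith
  then have "rdist i Q unit_cube \<le> (4 * max s 1 + p) / max s 1"
    unfolding rd by (intro divide_right_mono) auto
  also have "\<dots> = 4 + p / max s 1"
    by (simp add: add_divide_distrib)
  \<comment> \<open>Expanding by 4 lets the factor 4 be taken out of both summands; the new
    denominator dominates 1 + d because d \<le> s.\<close>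
  also have "p / max s 1 = 4 * p / (4 * max s 1)"
    by simp
  also have "\<dots> \<le> 4 * p / (1 + d)"
    using pd by (intro divide_left_mono) auto
  finally show "rdist i Q unit_cube \<le> 4 * (1 + infnorm (x + t) / (1 + infnorm (x - t)))"
    by (simp add: p_def d_def)
qed

section \<open>A cube and a point outside its fivefold dilate\<close>

text \<open>For the side, the competitor is the cube with centre c and side 2|x - c|: it reaches x,
  and it contains \<open>cube c l\<close> because |x - c| > 5l/2.\<close>

lemma joint_cube_point_bounds:
  fixes x c :: "real^'n" and i :: 'n
  assumes l: "l > 0" and x: "x \<notin> cube c (5 * l)"
  defines "Q \<equiv> joint_cube i (cube c l) {x}"
  shows "is_cube_or_point Q" "cube c l \<subseteq> Q" "x \<in> Q" "side Q \<le> 2 * infnorm (x - c)"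
proof -
  have bd: "bounded (cube c l)" "bounded {x}" "cube c l \<union> {x} \<noteq> {}"
    by (auto simp: compact_cube compact_imp_bounded)
  show "is_cube_or_point Q" "cube c l \<subseteq> Q" "x \<in> Q"
    using is_cube_or_point_joint_cube[OF bd] joint_cube_superset[OF bd] by (auto simp: Q_def)
  show "side Q \<le> 2 * infnorm (x - c)"
    unfolding Q_def using x l
    by (intro side_joint_cube_le[OF bd]) (auto simp: mem_cube_iff infnorm_pos_le)
qed

text \<open>Since |t - c| \<le> l/2 and |x - c| > 5l/2, replacing c by t costs at most a fifth of |x
  - c|. The second bound leaves room for the condition 2|x - x'| < |x - t| of kernel
  regularity.\<close>

lemma infnorm_diff_outside_cube:
  fixes x t c :: "real^'n"
  assumes "x \<notin> cube c (5 * l)" "t \<in> cube c l"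
  shows "infnorm (x - t) \<ge> 4 / 5 * infnorm (x - c)" "infnorm (x - t) > 2 * l"
proof -
  have "infnorm (x - c) \<le> infnorm (x - t) + infnorm (t - c)"
    using infnorm_triangle[of "x - t" "t - c"] by simp
  then show "infnorm (x - t) \<ge> 4 / 5 * infnorm (x - c)" "infnorm (x - t) > 2 * l"
    using assms by (auto simp: mem_cube_iff)
qed

lemma infnorm_outside_cube_gt:
  "x \<notin> cube c (5 * l) \<Longrightarrow> l > 0 \<Longrightarrow> infnorm (x - c) > 5 / 2 * l"
  by (simp add: mem_cube_iff)

section \<open>Integrals over a cube, and mollifiers as an approximate identity\<close>

definition kernel_integral ::
  "(real^'n \<Rightarrow> real^'n \<Rightarrow> complex) \<Rightarrow> (real^'n \<Rightarrow> complex) \<Rightarrow> real^'n \<Rightarrow> complex" where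
  "kernel_integral K f x = (LINT t|lebesgue. f t * K x t)"

lemma norm_integral_mult_cube_le:
  fixes f k :: "real^'n \<Rightarrow> complex"
  assumes l: "l \<ge> 0" and f: "vanishes_outside f (cube c l)" "\<And>t. norm (f t) \<le> M"
    and k: "\<And>t. t \<in> cube c l \<Longrightarrow> norm (k t) \<le> B" and B: "B \<ge> 0"
  shows "norm (LINT t|lebesgue. f t * k t) \<le> M * B * l ^ CARD('n)"
proof -
  have M: "M \<ge> 0" using f(2)[of c] norm_ge_zero order_trans by blast
  show ?thesis
  proof (cases "integrable lebesgue (\<lambda>t. f t * k t)")
    case True
    have "cube c l \<in> lmeasurable"
      by (simp add: cube_def)
    then have ind: "integrable lebesgue (indicat_real (cube c l))"
      by (intro integrable_real_indicator) (auto simp: fmeasurable_def)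
    have "norm (LINT t|lebesgue. f t * k t) \<le> (LINT t|lebesgue. (M * B) * indicator (cube c l) t)"
      using f k M B
      by (intro Bochner_Integration.integral_norm_bound_integral True integrable_mult_right ind)
        (auto simp: vanishes_outside_def norm_mult indicator_def intro!: mult_mono)
    also have "\<dots> = M * B * l ^ CARD('n)"
      using l by (simp add: measure_cube)
    finally show ?thesis .
  next
    \<comment> \<open>The Bochner integral of a non-integrable function is 0 by default, so only the
      sign of the right-hand side matters here.\<close>
    case False
    then show ?thesis
      using M B l by (simp add: not_integrable_integral_eq)
  qed
qed

lemma scaled_mem_unit_cube_iff:
  assumes "e > 0"
  shows "(y - x) /\<^sub>R e \<in> unit_cube \<longleftrightarrow> y \<in> cube x e"
proof -
  have "infnorm ((y - x) /\<^sub>R e) = infnorm (y - x) / e"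
    using assms by (simp only: infnorm_mul) (simp add: field_simps)
  then show ?thesis
    using assms unfolding unit_cube_def mem_cube_iff diff_0_right by (simp only:) (simp add: field_simps)
qed

lemma mollifier_continuous: "mollifier \<Phi> \<Longrightarrow> continuous_on UNIV \<Phi>"
  unfolding mollifier_def schwartz_def
  by (auto simp: iter_partial_def intro!: continuous_at_imp_continuous_on
      dest!: spec[of _ "[]"] differentiable_imp_continuous_within)

text \<open>The substitution y = x + e z, with \<open>lborel\<close> written as a multiple of its
  image under that map. It gives the rescaled mollifiers mass 1.\<close>

lemma integral_lborel_affine:
  fixes f :: "'a::euclidean_space \<Rightarrow> real"
  assumes f [measurable]: "f \<in> borel_measurable borel" and e: "e > 0"
  shows "(LINT y|lborel. f ((y - x) /\<^sub>R e)) = e ^ DIM('a) * (LINT y|lborel. f y)"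
proof -
  have "(lborel :: 'a measure) = density (distr lborel borel (\<lambda>z. x + e *\<^sub>R z)) (\<lambda>_. e ^ DIM('a))"
    using lborel_affine[of e x] e by simp
  then have "(LINT y|lborel. f ((y - x) /\<^sub>R e)) =
      (LINT y|density (distr lborel borel (\<lambda>z. x + e *\<^sub>R z)) (\<lambda>_. e ^ DIM('a)). f ((y - x) /\<^sub>R e))"
    by simp
  also have "\<dots> = (LINT y|distr lborel borel (\<lambda>z. x + e *\<^sub>R z). e ^ DIM('a) * f ((y - x) /\<^sub>R e))"
    using e by (subst integral_density) auto
  also have "\<dots> = (LINT z|lborel. e ^ DIM('a) * f z)"
    using e by (subst integral_distr) auto
  finally show ?thesis by simp
qed

text \<open>The rescaled mollifier is a probability density on the cube of side e about x, so the
  error is an average of h(y) - h(x) over that cube, which continuity at x makes small.\<close>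

lemma rescaled_tendsto:
  fixes h :: "real^'n \<Rightarrow> complex"
  assumes \<Phi>: "mollifier \<Phi>" and U: "open U" "x \<in> U" and h: "continuous_on U h"
  shows "((\<lambda>e. LINT y|lebesgue. rescaled \<Phi> x e y * h y) \<longlongrightarrow> h x) (at_right 0)"
proof (rule tendstoI)
  fix r :: real assume r: "r > 0"
  have "isCont h x"
    using U h continuous_on_eq_continuous_at by blast
  then obtain d1 where d1: "d1 > 0" "\<And>y. dist y x < d1 \<Longrightarrow> dist (h y) (h x) < r / 2"
    using r unfolding continuous_at_eps_delta by (metis half_gt_zero)
  \<comment> \<open>Keeps the small cube inside U; outside U the function h is arbitrary.\<close>
  obtain d2 where d2: "d2 > 0" "\<And>y. dist y x < d2 \<Longrightarrow> y \<in> U"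
    using U open_dist by blast
  \<comment> \<open>The square root of the dimension converts the max norm, in which cubes are
    balls, into the Euclidean distance of d1 and d2.\<close>
  define d where "d = min d1 d2 / sqrt (CARD('n))"
  have d: "d > 0" using d1 d2 by (simp add: d_def)
  have "dist (LINT y|lebesgue. rescaled \<Phi> x e y * h y) (h x) < r" if e: "0 < e" "e < d" for e
  proof -
    define \<psi> where "\<psi> y = \<Phi> ((y - x) /\<^sub>R e) / e ^ CARD('n)" for y
    have g: "rescaled \<Phi> x e = (\<lambda>y. complex_of_real (\<psi> y))"
      by (simp add: fun_eq_iff rescaled_def \<psi>_def)
    have c\<Phi>: "continuous_on UNIV \<Phi>" by (rule mollifier_continuous[OF \<Phi>])
    have \<psi>c: "continuous_on A \<psi>" for A
      unfolding \<psi>_def using e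
      by (intro continuous_intros continuous_on_compose2[OF c\<Phi>]) auto
    have [measurable]: "\<Phi> \<in> borel_measurable borel" "\<psi> \<in> borel_measurable borel"
      using c\<Phi> \<psi>c by (auto intro: borel_measurable_continuous_onI)
    have \<psi>0: "\<psi> y \<ge> 0" for y
      using \<Phi> e by (auto simp: \<psi>_def mollifier_def)
    have out: "\<psi> y = 0" if "y \<notin> cube x e" for y
    proof -
      have "(y - x) /\<^sub>R e \<notin> unit_cube"
        using that e by (simp only: scaled_mem_unit_cube_iff not_False_eq_True)
      then show ?thesis
        using \<Phi> by (simp add: \<psi>_def mollifier_def vanishes_outside_def)
    qed
    have near: "dist y x < min d1 d2" if "y \<in> cube x e" for y
    proof -
      have "norm (y - x) \<le> sqrt (CARD('n)) * infnorm (y - x)"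
        using norm_le_infnorm[of "y - x"] by simp
      also have "\<dots> < sqrt (CARD('n)) * d"
        using that e d by (intro mult_strict_left_mono) (auto simp: mem_cube_iff)
      also have "\<dots> = min d1 d2" by (simp add: d_def)
      finally show ?thesis by (simp add: dist_norm)
    qed
    have int: "integrable lebesgue (\<lambda>y. complex_of_real (\<psi> y) * k y)"
      if k: "continuous_on (cube x e) k" for k
    proof -
      \<comment> \<open>A continuous function on a compact set is integrable; the indicator changes
        nothing because \<psi> vanishes off the cube.\<close>
      have "integrable lborel (\<lambda>y. indicator (cube x e) y *\<^sub>R (complex_of_real (\<psi> y) * k y))"
        by (intro borel_integrable_compact compact_cube continuous_intros \<psi>c k)
      moreover have "(\<lambda>y. indicator (cube x e) y *\<^sub>R (complex_of_real (\<psi> y) * k y))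
          = (\<lambda>y. complex_of_real (\<psi> y) * k y)"
        using out by (auto simp: fun_eq_iff indicator_def)
      ultimately have I: "integrable lborel (\<lambda>y. complex_of_real (\<psi> y) * k y)" by simp
      then show ?thesis
        by (subst integrable_completion) auto
    qed
    have ch: "continuous_on (cube x e) h"
      using near d2 by (intro continuous_on_subset[OF h]) auto
    have ci: "integrable lebesgue (\<lambda>y. complex_of_real (\<psi> y))"
      using int[of "\<lambda>_. 1"] by simp
    then have ri: "integrable lebesgue \<psi>"
      using complex_of_real_integrable_eq by blast
    have "(LINT y|lebesgue. \<psi> y) = (LINT y|lborel. \<psi> y)"
      by (subst integral_completion) auto
    also have "\<dots> = (LINT y|lborel. \<Phi> ((y - x) /\<^sub>R e)) / e ^ CARD('n)"
      by (simp add: \<psi>_def[abs_def])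
    also have "\<dots> = (LINT y|lborel. \<Phi> y)"
      using e by (subst integral_lborel_affine) auto
    also have "\<dots> = 1"
      using \<Phi> by (simp add: mollifier_def integral_completion)
    finally have one: "(LINT y|lebesgue. \<psi> y) = 1" .
    have "(LINT y|lebesgue. rescaled \<Phi> x e y * h y) - h x
        = (LINT y|lebesgue. complex_of_real (\<psi> y) * h y) - (LINT y|lebesgue. complex_of_real (\<psi> y) * h x)"
      using one by (simp add: g)
    also have "\<dots> = (LINT y|lebesgue. complex_of_real (\<psi> y) * (h y - h x))"
      unfolding right_diff_distrib
      by (intro Bochner_Integration.integral_diff[symmetric] int ch continuous_intros)
    also have "norm \<dots> \<le> (LINT y|lebesgue. \<psi> y * (r / 2))"
    proof (rule Bochner_Integration.integral_norm_bound_integral)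
      show "integrable lebesgue (\<lambda>y. complex_of_real (\<psi> y) * (h y - h x))"
        by (intro int continuous_intros ch)
      show "integrable lebesgue (\<lambda>y. \<psi> y * (r / 2))"
        using ri by simp
      fix y
      show "norm (complex_of_real (\<psi> y) * (h y - h x)) \<le> \<psi> y * (r / 2)"
      proof (cases "y \<in> cube x e")
        case True
        then show ?thesis
          using d1(2)[of y] near[of y] \<psi>0[of y]
          by (simp add: norm_mult dist_norm mult_left_mono del: times_divide_eq_right)
      qed (simp add: out)
    qed
    also have "\<dots> = r / 2"
      using one by simp
    finally show ?thesis
      using r by (simp add: dist_norm)
  qed
  then show "\<forall>\<^sub>F e in at_right 0. dist (LINT y|lebesgue. rescaled \<Phi> x e y * h y) (h x) < r"
    using d unfolding eventually_at_right_field by blast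
qed

text \<open>Turns decay in the distance r = |x - c| into decay in the weight w, with p = n for the
  size estimate and p = n + \<delta> for the smoothness estimate. The hypothesis says exactly that l
  / (4/5 r) \<le> 2 / w.\<close>

lemma powr_ratio_le:
  fixes l r w p :: real
  assumes "l > 0" "w > 0" "r > 0" "l * w \<le> 8 / 5 * r" "p \<ge> 0"
  shows "l powr p / (4 / 5 * r) powr p \<le> 2 powr p * w powr (- p)"
proof -
  have "l powr p / (4 / 5 * r) powr p = (l / (4 / 5 * r)) powr p"
    using assms by (intro powr_divide[symmetric])
  also have "\<dots> \<le> (2 / w) powr p"
    using assms by (intro powr_mono2) (auto simp: field_simps)
  also have "\<dots> = 2 powr p * w powr (- p)"
    using assms by (simp add: powr_divide powr_minus field_simps)
  finally show ?thesis .
qed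

section \<open>Kernel bounds uniform over the cube\<close>

text \<open>Fixes one witness \<open>CK\<close> for both kernel conditions, so that all later bounds
  have explicit constants and the final constant can be chosen before I and \<phi>.\<close>

locale CZ_kernel =
  fixes K :: "real^'n \<Rightarrow> real^'n \<Rightarrow> complex" and \<delta> CK :: real and L S D :: "real \<Rightarrow> real"
  assumes delta_pos: "\<delta> > 0" and CK_pos: "CK > 0" and admissible: "admissible L S D"
    and smooth: "2 * (infnorm (t - t') + infnorm (x - x')) < infnorm (t - x) \<Longrightarrow>
           norm (K t x - K t' x')
             \<le> CK * ((infnorm (t - t') + infnorm (x - x')) powr \<delta>
                       / infnorm (t - x) powr (real CARD('n) + \<delta>))
                 * L (infnorm (t - x)) * S (infnorm (t - t') + infnorm (x - x'))
                 * D (1 + infnorm (t + x) / (1 + infnorm (t - x)))"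
    and size: "t \<noteq> x \<Longrightarrow>
           norm (K t x)
             \<le> CK * (1 / infnorm (t - x) ^ CARD('n))
                 * L (infnorm (t - x)) * S (infnorm (t - x))
                 * D (1 + infnorm (t + x) / (1 + infnorm (t - x)))"
begin

lemma nonneg: "y \<ge> 0 \<Longrightarrow> L y \<ge> 0" "y \<ge> 0 \<Longrightarrow> S y \<ge> 0" "y \<ge> 0 \<Longrightarrow> D y \<ge> 0"
  using admissible by (auto simp: admissible_def)

lemma mono:
  "0 \<le> y \<Longrightarrow> y \<le> z \<Longrightarrow> L z \<le> L y"
  "0 \<le> y \<Longrightarrow> y \<le> z \<Longrightarrow> S y \<le> S z"
  "0 \<le> y \<Longrightarrow> y \<le> z \<Longrightarrow> D z \<le> D y"
  using admissible unfolding admissible_def monotone_on_def by auto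

text \<open>The source of \<kappa> = 1/4. \<open>D\<close> is non-increasing and the bound on
  \<open>rdist\<close> loses a factor 4. For \<open>L\<close>, |x - t| \<ge> 4/5 |x - c| \<ge> 2/5
  \<open>side Q\<close>, which is more than a quarter of \<open>side Q\<close>.\<close>

lemma L_D_outside_cube_le:
  fixes i :: 'n
  assumes l: "l > 0" and x: "x \<notin> cube c (5 * l)" and t: "t \<in> cube c l"
  defines "Q \<equiv> joint_cube i (cube c l) {x}"
  shows "L (infnorm (x - t)) \<le> L (1 / 4 * side Q)"
    and "D (1 + infnorm (x + t) / (1 + infnorm (x - t))) \<le> D (1 / 4 * rdist i Q unit_cube)"
    and "0 \<le> side Q" "infnorm (x - t) \<le> side Q" and "0 \<le> rdist i Q unit_cube"
proof -
  note Q = joint_cube_point_bounds[OF l x, of i, folded Q_def]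
  have tQ: "t \<in> Q" using Q(2) t by auto
  show xt: "infnorm (x - t) \<le> side Q"
    by (rule infnorm_diff_le_side[OF Q(1,3) tQ])
  then show s: "0 \<le> side Q"
    using infnorm_pos_le[of "x - t"] by linarith
  show "L (infnorm (x - t)) \<le> L (1 / 4 * side Q)"
    using s Q(4) infnorm_diff_outside_cube(1)[OF x t] infnorm_pos_le[of "x - c"]
    by (intro mono) auto
  note rd = rdist_unit_cube_le[OF Q(1,3) tQ, of i]
  show "0 \<le> rdist i Q unit_cube" by (fact rd)
  have quarter: "1 / 4 * a \<le> b" if "a \<le> 4 * b" for a b :: real
    using that by simp
  have "1 / 4 * rdist i Q unit_cube \<le> 1 + infnorm (x + t) / (1 + infnorm (x - t))"
    using quarter[OF rd(2)] .
  then show "D (1 + infnorm (x + t) / (1 + infnorm (x - t))) \<le> D (1 / 4 * rdist i Q unit_cube)"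
    using rd(1) by (intro mono) auto
qed

text \<open>Removes t from the size bound, so that it can be integrated over I as a constant. For
  the non-decreasing \<open>S\<close>, |x - t| \<le> \<open>side Q\<close> suffices, and dividing by
  1/4 only enlarges the argument.\<close>

lemma size_outside_cube:
  fixes i :: 'n
  assumes l: "l > 0" and x: "x \<notin> cube c (5 * l)" and t: "t \<in> cube c l"
  defines "Q \<equiv> joint_cube i (cube c l) {x}"
  shows "norm (K x t) \<le> CK * (1 / (4 / 5 * infnorm (x - c)) ^ CARD('n))
           * L (1 / 4 * side Q) * S (side Q / (1 / 4)) * D (1 / 4 * rdist i Q unit_cube)"
proof -
  note LD = L_D_outside_cube_le[OF l x t, of i, folded Q_def]
  note xt = infnorm_diff_outside_cube[OF x t]
  have r: "infnorm (x - c) > 0"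
    using infnorm_outside_cube_gt[OF x l] l by linarith
  have "x \<noteq> t"
    using xt(2) l infnorm_0[where 'a="real^'n"] by auto
  then have "norm (K x t) \<le> CK * (1 / infnorm (x - t) ^ CARD('n))
      * L (infnorm (x - t)) * S (infnorm (x - t)) * D (1 + infnorm (x + t) / (1 + infnorm (x - t)))"
    by (rule size)
  also have "\<dots> \<le> CK * (1 / (4 / 5 * infnorm (x - c)) ^ CARD('n))
           * L (1 / 4 * side Q) * S (side Q / (1 / 4)) * D (1 / 4 * rdist i Q unit_cube)"
    using CK_pos r xt LD
    by (intro mult_mono mult_nonneg_nonneg divide_left_mono power_mono mono LD nonneg
        mult_pos_pos zero_less_power)
      (auto simp: infnorm_pos_le intro!: divide_nonneg_nonneg add_nonneg_nonneg)
  finally show ?thesis .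
qed

lemma smooth_outside_cube:
  fixes i :: 'n
  assumes l: "l > 0" and x: "x \<notin> cube c (5 * l)" and t: "t \<in> cube c l"
    and xx': "infnorm (x - x') < l / 2"
  defines "Q \<equiv> joint_cube i (cube c l) {x}"
  shows "norm (K x t - K x' t) \<le> CK * (infnorm (x - x') powr \<delta>
             / (4 / 5 * infnorm (x - c)) powr (real CARD('n) + \<delta>))
           * L (1 / 4 * side Q) * S (infnorm (x - x') / (1 / 4)) * D (1 / 4 * rdist i Q unit_cube)"
proof -
  note LD = L_D_outside_cube_le[OF l x t, of i, folded Q_def]
  note xt = infnorm_diff_outside_cube[OF x t]
  have r: "infnorm (x - c) > 0"
    using infnorm_outside_cube_gt[OF x l] l by linarith
  have "norm (K x t - K x' t) \<le> CK * (infnorm (x - x') powr \<delta>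
        / infnorm (x - t) powr (real CARD('n) + \<delta>))
      * L (infnorm (x - t)) * S (infnorm (x - x')) * D (1 + infnorm (x + t) / (1 + infnorm (x - t)))"
    \<comment> \<open>Regularity applies because 2|x - x'| < l < 2l < |x - t|.\<close>
    using smooth[of x x' t t] xx' xt l by (simp add: infnorm_0)
  also have "\<dots> \<le> CK * (infnorm (x - x') powr \<delta>
             / (4 / 5 * infnorm (x - c)) powr (real CARD('n) + \<delta>))
           * L (1 / 4 * side Q) * S (infnorm (x - x') / (1 / 4)) * D (1 / 4 * rdist i Q unit_cube)"
    using CK_pos r xt LD delta_pos
    by (intro mult_mono mult_nonneg_nonneg divide_left_mono powr_mono2 mono LD nonneg
        mult_pos_pos)
      (auto simp: infnorm_pos_le intro!: divide_nonneg_nonneg add_nonneg_nonneg)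
  finally show ?thesis .
qed

text \<open>Moving only the second variable in the regularity condition gives a Hoelder bound of
  exponent \<delta> near t, with the \<open>S\<close> factor frozen at |x - t| by
  monotonicity.\<close>

lemma isCont_kernel:
  assumes "x \<noteq> t"
  shows "isCont (K x) t"
proof -
  define M where "M = CK * (1 / infnorm (x - t) powr (real CARD('n) + \<delta>))
      * L (infnorm (x - t)) * S (infnorm (x - t)) * D (1 + infnorm (x + t) / (1 + infnorm (x - t)))"
  have r: "infnorm (x - t) > 0" using assms by (simp add: infnorm_pos_lt)
  have lim: "((\<lambda>t'. infnorm (t - t')) \<longlongrightarrow> infnorm (t - t)) (at t)"
    by (intro tendsto_intros)
  have "\<forall>\<^sub>F t' in at t. infnorm (t - t') < infnorm (x - t) / 2"
    using r by (intro order_tendstoD(2)[OF lim]) (simp add: infnorm_0)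
  then have "\<forall>\<^sub>F t' in at t. norm (K x t' - K x t) \<le> M * infnorm (t - t') powr \<delta>"
  proof eventually_elim
    case (elim t')
    have "norm (K x t' - K x t) = norm (K x t - K x t')"
      by (rule norm_minus_commute)
    also have "\<dots> \<le> CK * (infnorm (t - t') powr \<delta> / infnorm (x - t) powr (real CARD('n) + \<delta>))
      * L (infnorm (x - t)) * S (infnorm (t - t')) * D (1 + infnorm (x + t) / (1 + infnorm (x - t)))"
      using smooth[of x x t t'] elim by (simp add: infnorm_0)
    also have "\<dots> \<le> CK * (infnorm (t - t') powr \<delta> / infnorm (x - t) powr (real CARD('n) + \<delta>))
      * L (infnorm (x - t)) * S (infnorm (x - t)) * D (1 + infnorm (x + t) / (1 + infnorm (x - t)))"
      using CK_pos r elim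
      by (intro mult_right_mono mult_left_mono mult_nonneg_nonneg mono nonneg)
        (auto simp: infnorm_pos_le intro!: divide_nonneg_nonneg add_nonneg_nonneg)
    also have "\<dots> = M * infnorm (t - t') powr \<delta>"
      by (simp add: M_def)
    finally show ?case .
  qed
  moreover have "((\<lambda>t'. M * infnorm (t - t') powr \<delta>) \<longlongrightarrow> M * infnorm (t - t) powr \<delta>) (at t)"
    using delta_pos by (intro tendsto_intros tendsto_powr' lim) (auto simp: infnorm_pos_le)
  then have "((\<lambda>t'. M * infnorm (t - t') powr \<delta>) \<longlongrightarrow> 0) (at t)"
    by (simp add: infnorm_0)
  ultimately have "((\<lambda>t'. K x t' - K x t) \<longlongrightarrow> 0) (at t)"
    by (rule Lim_null_comparison)
  then show ?thesis
    unfolding isCont_def by (rule LIM_zero_cancel)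
qed

section \<open>The kernel integral off the fivefold dilate\<close>

text \<open>On the compact cube the kernel is continuous, hence bounded, and measurable once cut off
  by the indicator; the cutoff leaves the product unchanged because f vanishes outside the
  cube.\<close>

lemma integrable_kernel:
  assumes l: "l > 0" and x: "x \<notin> cube c (5 * l)"
    and f: "f \<in> borel_measurable lebesgue" "vanishes_outside f (cube c l)" "\<And>t. norm (f t) \<le> M"
  shows "integrable lebesgue (\<lambda>t. f t * K x t)"
proof -
  have "continuous_on (cube c l) (K x)"
  proof (intro continuous_at_imp_continuous_on ballI isCont_kernel)
    fix t assume "t \<in> cube c l"
    then show "x \<noteq> t"
      using infnorm_diff_outside_cube(2)[OF x, of t] l infnorm_0[where 'a="real^'n"] by auto
  qed
  then obtain B where B: "\<And>t. t \<in> cube c l \<Longrightarrow> norm (K x t) \<le> B"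
    using compact_continuous_image[OF _ compact_cube] compact_imp_bounded bounded_iff
    by (metis imageI)
  have M: "M \<ge> 0" using f(3)[of c] norm_ge_zero order_trans by blast
  have "(\<lambda>t. indicator (cube c l) t *\<^sub>R K x t) \<in> borel_measurable borel"
    using \<open>continuous_on (cube c l) (K x)\<close>
    by (intro borel_measurable_continuous_on_indicator) (auto simp: cube_def)
  then have "(\<lambda>t. indicator (cube c l) t *\<^sub>R K x t) \<in> borel_measurable lebesgue"
    by (intro measurable_completion) simp
  with f(1) have "(\<lambda>t. f t * (indicator (cube c l) t *\<^sub>R K x t)) \<in> borel_measurable lebesgue"
    by (rule borel_measurable_times)
  moreover have "(\<lambda>t. f t * (indicator (cube c l) t *\<^sub>R K x t)) = (\<lambda>t. f t * K x t)"
    using f(2) by (auto simp: fun_eq_iff indicator_def vanishes_outside_def)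
  ultimately have "(\<lambda>t. f t * K x t) \<in> borel_measurable lebesgue" by simp
  then show ?thesis
    using emeasure_compact_finite[OF compact_cube, of c l] f B M
    by (intro integrableI_bounded_set[where A="cube c l" and B="M * B"])
      (auto simp: norm_mult vanishes_outside_def cube_def intro!: mult_mono)
qed

lemma kernel_integral_size:
  fixes i :: 'n
  assumes l: "l > 0" and x: "x \<notin> cube c (5 * l)"
    and f: "vanishes_outside f (cube c l)" "\<And>t. norm (f t) \<le> M"
  defines "Q \<equiv> joint_cube i (cube c l) {x}"
  shows "norm (kernel_integral K f x) \<le> M * (CK * (1 / (4 / 5 * infnorm (x - c)) ^ CARD('n))
           * L (1 / 4 * side Q) * S (side Q / (1 / 4)) * D (1 / 4 * rdist i Q unit_cube))
           * l ^ CARD('n)"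
  unfolding kernel_integral_def
proof (rule norm_integral_mult_cube_le[where c=c])
  \<comment> \<open>The majorant dominates a norm at the point t = c, so it is nonnegative.\<close>
  have "c \<in> cube c l" using l by (simp add: mem_cube_iff infnorm_0)
  then show "0 \<le> CK * (1 / (4 / 5 * infnorm (x - c)) ^ CARD('n))
           * L (1 / 4 * side Q) * S (side Q / (1 / 4)) * D (1 / 4 * rdist i Q unit_cube)"
    using size_outside_cube[OF l x, of c i, folded Q_def] norm_ge_zero order_trans by blast
qed (use l f size_outside_cube[OF l x, of _ i, folded Q_def] in auto)

text \<open>Here both integrals must exist, so that their difference is a single integral of f
  against K(x,t) - K(x',t); this is why x' too is kept outside the dilate.\<close>

lemma kernel_integral_smooth:
  fixes i :: 'n
  assumes l: "l > 0" and x: "x \<notin> cube c (5 * l)" and x': "x' \<notin> cube c (5 * l)"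
    and xx': "infnorm (x - x') < l / 2"
    and f: "f \<in> borel_measurable lebesgue" "vanishes_outside f (cube c l)" "\<And>t. norm (f t) \<le> M"
  defines "Q \<equiv> joint_cube i (cube c l) {x}"
  shows "norm (kernel_integral K f x - kernel_integral K f x') \<le> M * (CK * (infnorm (x - x') powr \<delta>
             / (4 / 5 * infnorm (x - c)) powr (real CARD('n) + \<delta>))
           * L (1 / 4 * side Q) * S (infnorm (x - x') / (1 / 4)) * D (1 / 4 * rdist i Q unit_cube))
           * l ^ CARD('n)"
proof -
  note bound = smooth_outside_cube[OF l x _ xx', of _ i, folded Q_def]
  have "c \<in> cube c l" using l by (simp add: mem_cube_iff infnorm_0)
  note bound0 = order_trans[OF norm_ge_zero bound[OF this]]
  have "kernel_integral K f x - kernel_integral K f x' = (LINT t|lebesgue. f t * (K x t - K x' t))"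
    unfolding kernel_integral_def
    using integrable_kernel[OF l x f] integrable_kernel[OF l x' f]
    by (simp add: right_diff_distrib flip: Bochner_Integration.integral_diff)
  then show ?thesis
    using norm_integral_mult_cube_le[OF less_imp_le[OF l] f(2,3) bound bound0] by simp
qed

lemma continuous_on_kernel_integral:
  assumes l: "l > 0"
    and f: "f \<in> borel_measurable lebesgue" "vanishes_outside f (cube c l)" "\<And>t. norm (f t) \<le> M"
  shows "continuous_on (- cube c (5 * l)) (kernel_integral K f)"
proof (intro continuous_at_imp_continuous_on ballI)
  fix x assume "x \<in> - cube c (5 * l)"
  then have x: "x \<notin> cube c (5 * l)" by simp
  \<comment> \<open>Any coordinate serves: the joint cube enters only through the constant
    \<open>P\<close>.\<close>
  fix i :: 'n
  define Q where "Q = joint_cube i (cube c l) {x}"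
  \<comment> \<open>The factor S(2l) bounds \<open>S\<close> at 4|x - y| for all y with |x - y| <
    l/2, which leaves a constant times |x - y| to the power \<delta>.\<close>
  define P where "P = M * (CK * (1 / (4 / 5 * infnorm (x - c)) powr (real CARD('n) + \<delta>))
      * L (1 / 4 * side Q) * S (2 * l) * D (1 / 4 * rdist i Q unit_cube)) * l ^ CARD('n)"
  have M: "M \<ge> 0" using f(3)[of c] norm_ge_zero order_trans by blast
  have "c \<in> cube c l" using l by (simp add: mem_cube_iff infnorm_0)
  note LD = L_D_outside_cube_le[OF l x this, of i, folded Q_def]
  have lim: "((\<lambda>y. infnorm (x - y)) \<longlongrightarrow> infnorm (x - x)) (at x)"
    by (intro tendsto_intros)
  have "\<forall>\<^sub>F y in at x. infnorm (x - y) < l / 2"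
    using l by (intro order_tendstoD(2)[OF lim]) (simp add: infnorm_0)
  moreover have "\<forall>\<^sub>F y in at x. y \<in> - cube c (5 * l)"
    using x by (intro eventually_at_in_open') (auto simp: cube_def open_Compl)
  ultimately have "\<forall>\<^sub>F y in at x. norm (kernel_integral K f y - kernel_integral K f x)
      \<le> P * infnorm (x - y) powr \<delta>"
  proof eventually_elim
    case (elim y)
    have "norm (kernel_integral K f y - kernel_integral K f x)
        = norm (kernel_integral K f x - kernel_integral K f y)"
      by (rule norm_minus_commute)
    also have "\<dots> \<le> M * (CK * (infnorm (x - y) powr \<delta>
             / (4 / 5 * infnorm (x - c)) powr (real CARD('n) + \<delta>))
           * L (1 / 4 * side Q) * S (infnorm (x - y) / (1 / 4)) * D (1 / 4 * rdist i Q unit_cube))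
           * l ^ CARD('n)"
      using kernel_integral_smooth[OF l x _ _ f, of y i, folded Q_def] elim by simp
    also have "\<dots> \<le> M * (CK * (infnorm (x - y) powr \<delta>
             / (4 / 5 * infnorm (x - c)) powr (real CARD('n) + \<delta>))
           * L (1 / 4 * side Q) * S (2 * l) * D (1 / 4 * rdist i Q unit_cube))
           * l ^ CARD('n)"
      using CK_pos M elim l LD
      by (intro mult_right_mono mult_left_mono mult_nonneg_nonneg mono nonneg)
        (auto simp: infnorm_pos_le intro!: divide_nonneg_nonneg)
    also have "\<dots> = P * infnorm (x - y) powr \<delta>"
      by (simp add: P_def)
    finally show ?case .
  qed
  moreover have "((\<lambda>y. P * infnorm (x - y) powr \<delta>) \<longlongrightarrow> P * infnorm (x - x) powr \<delta>) (at x)"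
    using delta_pos by (intro tendsto_intros tendsto_powr' lim) (auto simp: infnorm_pos_le)
  then have "((\<lambda>y. P * infnorm (x - y) powr \<delta>) \<longlongrightarrow> 0) (at x)"
    by (simp add: infnorm_0)
  ultimately have "((\<lambda>y. kernel_integral K f y - kernel_integral K f x) \<longlongrightarrow> 0) (at x)"
    by (rule Lim_null_comparison)
  then show "isCont (kernel_integral K f) x"
    unfolding isCont_def by (rule LIM_zero_cancel)
qed

section \<open>Pointwise values as kernel integrals\<close>

lemma point_value_eq_kernel_integral:
  assumes T: "associated_with T K" and \<Phi>: "mollifier \<Phi>" and l: "l > 0" and x: "x \<notin> cube c (5 * l)"
    and f: "f \<in> borel_measurable lebesgue" "vanishes_outside f (cube c l)" "\<And>t. norm (f t) \<le> M"
  shows "point_value T K \<Phi> f x = kernel_integral K f x"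
  unfolding point_value_def
proof (rule tendsto_Lim)
  have closed: "closed (cube a r)" for a :: "real^'n" and r
    by (rule compact_imp_closed[OF compact_cube])
  have supp_f: "supp f \<subseteq> cube c l"
    unfolding supp_def using f(2) by (intro closure_minimal closed) (auto simp: vanishes_outside_def)
  have "ext_pairing T K f (rescaled \<Phi> x e)
      = (LINT y|lebesgue. rescaled \<Phi> x e y * kernel_integral K f y)" if e: "0 < e" "e < l" for e
  proof -
    have "supp (rescaled \<Phi> x e) \<subseteq> cube x e"
      unfolding supp_def
    proof (intro closure_minimal closed subsetI)
      fix y assume "y \<in> {y. rescaled \<Phi> x e y \<noteq> 0}"
      then have "(y - x) /\<^sub>R e \<in> unit_cube"
        using \<Phi> by (auto simp: rescaled_def mollifier_def vanishes_outside_def)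
      then show "y \<in> cube x e"
        using e by (simp only: scaled_mem_unit_cube_iff)
    qed
    \<comment> \<open>A common point would be at distance more than 2l from x, but also at most e/2
      < l/2.\<close>
    moreover have "cube c l \<inter> cube x e = {}"
      using infnorm_diff_outside_cube(2)[OF x] e l by (force simp: mem_cube_iff infnorm_sub)
    ultimately have "supp f \<inter> supp (rescaled \<Phi> x e) = {}"
      using supp_f by blast
    \<comment> \<open>If both functions lie in \<open>Cc\<close>, association with K applies to the
      disjoint supports; otherwise this is the definition of the extended pairing.\<close>
    then have "ext_pairing T K f (rescaled \<Phi> x e) = kernel_pairing K f (rescaled \<Phi> x e)"
      using T by (auto simp: ext_pairing_def associated_with_def)
    also have "\<dots> = (LINT y|lebesgue. rescaled \<Phi> x e y * kernel_integral K f y)"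
      unfolding kernel_pairing_def kernel_integral_def
      by (intro arg_cong[where f="integral\<^sup>L lebesgue"] ext)
        (simp add: mult_ac flip: integral_mult_right_zero)
    finally show ?thesis .
  qed
  then have "\<forall>\<^sub>F e in at_right 0. (LINT y|lebesgue. rescaled \<Phi> x e y * kernel_integral K f y)
      = ext_pairing T K f (rescaled \<Phi> x e)"
    unfolding eventually_at_right_field using l by auto
  moreover have "((\<lambda>e. LINT y|lebesgue. rescaled \<Phi> x e y * kernel_integral K f y)
      \<longlongrightarrow> kernel_integral K f x) (at_right 0)"
    using x closed by (intro rescaled_tendsto[OF \<Phi> _ _ continuous_on_kernel_integral[OF l f]]) auto
  ultimately show "((\<lambda>e. ext_pairing T K f (rescaled \<Phi> x e)) \<longlongrightarrow> kernel_integral K f x) (at_right 0)"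
    by (rule Lim_transform_eventually[rotated])
qed simp

section \<open>The two estimates for a bump function\<close>

context
  fixes i :: 'n and T C N \<phi> and \<Phi> :: "real^'n \<Rightarrow> real" and I :: "(real^'n) set"
  assumes T: "associated_with T K" and \<Phi>: "mollifier \<Phi>" and cube: "is_cube I" and C: "C > 0"
    and bump: "bump_order_zero I C N \<phi>" and van: "vanishes_outside \<phi> I"
begin

text \<open>The decay factor has base at least 1 and exponent at most 0. The resulting uniform bound
  is the \<open>M\<close> of the integral estimates.\<close>

lemma norm_bump_le: "norm (\<phi> t) \<le> C * vol I powr (- 1 / 2)"
proof -
  have "infnorm (t - centre I) / side I \<ge> 0"
    using cube by (auto simp: is_cube_def side_cube infnorm_pos_le)
  then have "(1 + infnorm (t - centre I) / side I) powr (- real N) \<le> 1"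
    using powr_mono[of "- real N" 0 "1 + infnorm (t - centre I) / side I"] by simp
  then have "C * vol I powr (- 1 / 2) * (1 + infnorm (t - centre I) / side I) powr (- real N)
      \<le> C * vol I powr (- 1 / 2) * 1"
    using C by (intro mult_left_mono) auto
  moreover have "norm (\<phi> t) \<le> C * vol I powr (- 1 / 2) * (1 + infnorm (t - centre I) / side I) powr (- real N)"
    using bump by (simp add: bump_order_zero_def)
  ultimately show ?thesis by simp
qed

lemma point_value_bump:
  assumes "x \<notin> dilate 5 I"
  shows "point_value T K \<Phi> \<phi> x = kernel_integral K \<phi> x"
proof -
  obtain c l where "l > 0" "I = cube c l"
    using cube by (auto simp: is_cube_def)
  then show ?thesis
    using assms van bump norm_bump_le
    by (intro point_value_eq_kernel_integral[OF T \<Phi>]) (auto simp: bump_order_zero_def dilate_cube)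
qed

lemma point_value_size:
  assumes out: "x \<notin> dilate 5 I"
  shows "norm (point_value T K \<Phi> \<phi> x)
           \<le> (CK * 2 powr (real CARD('n) + \<delta>)) * C * vol I powr (-1/2)
               * weight I x powr (- real CARD('n))
               * F_fun i (\<lambda>y. L (1 / 4 * y)) (\<lambda>y. S (y / (1 / 4))) (\<lambda>y. D (1 / 4 * y))
                   (joint_cube i I {x})"
proof -
  obtain c l where l: "l > 0" and I: "I = cube c l"
    using cube by (auto simp: is_cube_def)
  have side: "side I = l" and centre: "centre I = c" and dil: "dilate 5 I = cube c (5 * l)"
    using l by (simp_all add: I side_cube centre_cube dilate_cube)
  define M where "M = C * vol I powr (- 1 / 2)"
  have M: "M \<ge> 0" using C by (simp add: M_def)
  note bd = norm_bump_le[folded M_def]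
  have x: "x \<notin> cube c (5 * l)" using out by (simp add: dil)
  define r Q w where "r = infnorm (x - c)" and "Q = joint_cube i I {x}" and "w = weight I x"
  define F where "F = L (1 / 4 * side Q) * S (side Q / (1 / 4)) * D (1 / 4 * rdist i Q unit_cube)"
  have r: "r > 5 / 2 * l" using infnorm_outside_cube_gt[OF x l] by (simp add: r_def)
  have w: "w = 1 + r / l" by (simp add: w_def weight_def side centre r_def)
  have "c \<in> cube c l" using l by (simp add: mem_cube_iff infnorm_0)
  note LD = L_D_outside_cube_le[OF l x this, of i, folded I, folded Q_def]
  have F: "F \<ge> 0"
    unfolding F_def using LD by (intro mult_nonneg_nonneg nonneg) auto
  have "l ^ CARD('n) / (4 / 5 * r) ^ CARD('n) = l powr CARD('n) / (4 / 5 * r) powr CARD('n)"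
    using l r by (simp add: powr_realpow)
  also have "\<dots> \<le> 2 powr CARD('n) * w powr (- real CARD('n))"
    \<comment> \<open>Here l w = l + r, and l < 2/5 r gives l w < 7/5 r.\<close>
    using l r by (intro powr_ratio_le) (auto simp: w field_simps)
  \<comment> \<open>The constant is enlarged so that both estimates share it.\<close>
  also have "\<dots> \<le> 2 powr (real CARD('n) + \<delta>) * w powr (- real CARD('n))"
    using delta_pos by (intro mult_right_mono powr_mono) auto
  finally have ratio: "l ^ CARD('n) / (4 / 5 * r) ^ CARD('n)
      \<le> 2 powr (real CARD('n) + \<delta>) * w powr (- real CARD('n))" .
  have "norm (point_value T K \<Phi> \<phi> x) \<le> M * (CK * (1 / (4 / 5 * r) ^ CARD('n))
           * L (1 / 4 * side Q) * S (side Q / (1 / 4)) * D (1 / 4 * rdist i Q unit_cube))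
           * l ^ CARD('n)"
    unfolding point_value_bump[OF out]
    by (rule kernel_integral_size[OF l x van[unfolded I] bd, of i, folded I, folded Q_def r_def])
  also have "\<dots> = M * CK * F * (l ^ CARD('n) / (4 / 5 * r) ^ CARD('n))"
    by (simp only: F_def times_divide_eq_left times_divide_eq_right mult_1 mult_ac)
  also have "\<dots> \<le> M * CK * F * (2 powr (real CARD('n) + \<delta>) * w powr (- real CARD('n)))"
    using M CK_pos F by (intro mult_left_mono ratio mult_nonneg_nonneg) auto
  also have "\<dots> = (CK * 2 powr (real CARD('n) + \<delta>)) * C * vol I powr (-1/2)
      * w powr (- real CARD('n)) * F"
    by (simp only: M_def mult_ac)
  finally show ?thesis
    by (simp only: F_fun_def F_def Q_def w_def)
qed

lemma point_value_smooth:
  assumes out: "x \<notin> dilate 5 I" and close: "infnorm (x - x') < side I / 2"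
    and disj: "joint_cube i {x} {x'} \<inter> dilate 5 I = {}"
  shows "norm (point_value T K \<Phi> \<phi> x - point_value T K \<Phi> \<phi> x')
           \<le> (CK * 2 powr (real CARD('n) + \<delta>)) * C * (infnorm (x - x') powr \<delta> / side I powr \<delta>)
               * vol I powr (-1/2)
               * weight I ((x + x') /\<^sub>R 2) powr (- (real CARD('n) + \<delta>))
               * L (1 / 4 * side (joint_cube i I {x}))
               * S (infnorm (x - x') / (1 / 4))
               * D (1 / 4 * rdist i (joint_cube i I {x}) unit_cube)"
proof -
  obtain c l where l: "l > 0" and I: "I = cube c l"
    using cube by (auto simp: is_cube_def)
  have side: "side I = l" and centre: "centre I = c" and dil: "dilate 5 I = cube c (5 * l)"
    using l by (simp_all add: I side_cube centre_cube dilate_cube)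
  define M where "M = C * vol I powr (- 1 / 2)"
  have M: "M \<ge> 0" using C by (simp add: M_def)
  note bd = norm_bump_le[folded M_def]
  have meas: "\<phi> \<in> borel_measurable lebesgue"
    using bump by (simp add: bump_order_zero_def)
  have x: "x \<notin> cube c (5 * l)" and near: "infnorm (x - x') < l / 2"
    using out close by (simp_all add: dil side)
  \<comment> \<open>The disjointness hypothesis is used at the point x' of the joint cube, which
    puts x' outside the dilate.\<close>
  have "x' \<in> joint_cube i {x} {x'}"
    using joint_cube_superset(2)[of "{x}" "{x'}" i] by simp
  then have x': "x' \<notin> cube c (5 * l)" using disj dil by blast
  define r Q w where "r = infnorm (x - c)" and "Q = joint_cube i I {x}"
    and "w = weight I ((x + x') /\<^sub>R 2)"
  define F where "F = L (1 / 4 * side Q) * S (infnorm (x - x') / (1 / 4))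
      * D (1 / 4 * rdist i Q unit_cube)"
  define d where "d = infnorm (x - x') powr \<delta>"
  define p where "p = real CARD('n) + \<delta>"
  have r: "r > 5 / 2 * l" using infnorm_outside_cube_gt[OF x l] by (simp add: r_def)
  \<comment> \<open>The midpoint is within l/4 of x, so l w \<le> r + 5/4 l < 3/2 r, inside the 8/5
    r that \<open>powr_ratio_le\<close> requires.\<close>
  have mid: "(x + x') /\<^sub>R 2 - c = (x - c) + (1 / 2) *\<^sub>R (x' - x)"
    by (simp add: vec_eq_iff field_simps)
  have "infnorm ((x + x') /\<^sub>R 2 - c) \<le> r + infnorm (x' - x) / 2"
    using infnorm_triangle[of "x - c" "(1 / 2) *\<^sub>R (x' - x)"]
    unfolding mid infnorm_mul r_def by simp
  then have "infnorm ((x + x') /\<^sub>R 2 - c) \<le> r + l / 4"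
    using near by (simp add: infnorm_sub)
  moreover have "l + b \<le> 8 / 5 * r" if "b \<le> r + l / 4" for b
    using that r l by linarith
  ultimately have "l + infnorm ((x + x') /\<^sub>R 2 - c) \<le> 8 / 5 * r"
    by blast
  moreover have "l * w = l + infnorm ((x + x') /\<^sub>R 2 - c)"
    unfolding w_def weight_def side centre using l by (simp only: field_simps) simp
  ultimately have w: "l * w \<le> 8 / 5 * r" by simp
  have w0: "w > 0"
    unfolding w_def weight_def side centre
    using l infnorm_pos_le by (metis add_pos_nonneg divide_nonneg_pos zero_less_one)
  have "c \<in> cube c l" using l by (simp add: mem_cube_iff infnorm_0)
  note LD = L_D_outside_cube_le[OF l x this, of i, folded I, folded Q_def]
  have F: "F \<ge> 0"
    unfolding F_def using LD
    by (intro mult_nonneg_nonneg nonneg) (auto simp: infnorm_pos_le)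
  \<comment> \<open>The volume supplies only the power n of l; completing it to p = n + \<delta>
    leaves the factor 1 / l^\<delta> that normalizes |x - x'|^\<delta>.\<close>
  have "l ^ CARD('n) / (4 / 5 * r) powr p = l powr p / (4 / 5 * r) powr p / l powr \<delta>"
    using l by (simp add: p_def powr_add powr_realpow)
  also have "\<dots> \<le> 2 powr p * w powr (- p) / l powr \<delta>"
    using l r w w0 delta_pos by (intro divide_right_mono powr_ratio_le) (simp_all add: p_def)
  finally have ratio: "l ^ CARD('n) / (4 / 5 * r) powr p \<le> 2 powr p * w powr (- p) / l powr \<delta>" .
  have "norm (point_value T K \<Phi> \<phi> x - point_value T K \<Phi> \<phi> x')
      \<le> M * (CK * (d / (4 / 5 * r) powr p)
           * L (1 / 4 * side Q) * S (infnorm (x - x') / (1 / 4)) * D (1 / 4 * rdist i Q unit_cube))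
           * l ^ CARD('n)"
    unfolding point_value_bump[OF out] point_value_bump[OF x'[folded dil]]
    by (rule kernel_integral_smooth[OF l x x' near meas van[unfolded I] bd, of i,
          folded I, folded Q_def r_def p_def d_def])
  also have "\<dots> = M * CK * F * d * (l ^ CARD('n) / (4 / 5 * r) powr p)"
    by (simp only: F_def times_divide_eq_left times_divide_eq_right mult_ac)
  also have "\<dots> \<le> M * CK * F * d * (2 powr p * w powr (- p) / l powr \<delta>)"
    using M CK_pos F by (intro mult_left_mono ratio mult_nonneg_nonneg) (auto simp: d_def)
  also have "\<dots> = (CK * 2 powr p) * C * (d / l powr \<delta>) * vol I powr (-1/2) * w powr (- p) * F"
    by (simp only: M_def times_divide_eq_left times_divide_eq_right mult_ac)
  finally show ?thesis
    by (simp only: F_def Q_def w_def p_def d_def side mult.assoc)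
qed

end

end

section \<open>Choice of the constants and conclusion\<close>

theorem corollary4p6:
  fixes i :: "'n::finite" and \<delta> :: real
  assumes "0 < \<delta>" and "\<delta> < 1"
  shows "\<exists>\<kappa>::real. 0 < \<kappa> \<and> \<kappa> \<le> 1 \<and>
    (\<forall>(K :: real^'n \<Rightarrow> real^'n \<Rightarrow> complex) L S D T \<Phi>.
       compact_CZ_kernel \<delta> L S D K \<and> cont_linear_operator T \<and> associated_with T K \<and> mollifier \<Phi> \<longrightarrow>
       (\<exists>A>0. \<forall>(I :: (real^'n) set) C N \<phi>.
          is_cube I \<and> C > 0 \<and> bump_order_zero I C N \<phi> \<and> vanishes_outside \<phi> I \<longrightarrow>
          (\<forall>x. x \<notin> dilate 5 I \<longrightarrow>
             norm (point_value T K \<Phi> \<phi> x)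
               \<le> A * C * vol I powr (-1/2) * weight I x powr (- real CARD('n))
                   * F_fun i (\<lambda>y. L (\<kappa> * y)) (\<lambda>y. S (y / \<kappa>)) (\<lambda>y. D (\<kappa> * y))
                       (joint_cube i I {x})) \<and>
          (\<forall>x x'. x \<notin> dilate 5 I \<and> infnorm (x - x') < side I / 2
                    \<and> joint_cube i {x} {x'} \<inter> dilate 5 I = {} \<longrightarrow>
             norm (point_value T K \<Phi> \<phi> x - point_value T K \<Phi> \<phi> x')
               \<le> A * C * (infnorm (x - x') powr \<delta> / side I powr \<delta>) * vol I powr (-1/2)
                   * weight I ((x + x') /\<^sub>R 2) powr (- (real CARD('n) + \<delta>))
                   * L (\<kappa> * side (joint_cube i I {x}))
                   * S (infnorm (x - x') / \<kappa>)
                   * D (\<kappa> * rdist i (joint_cube i I {x}) unit_cube))))"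
proof (rule exI[of _ "1 / 4"], intro conjI allI impI, goal_cases)
  case (3 K L S D T \<Phi>)
  then have K: "compact_CZ_kernel \<delta> L S D K" and T: "associated_with T K" and \<Phi>: "mollifier \<Phi>"
    by simp_all
  have "\<exists>CK. CZ_kernel K \<delta> CK L S D"
    using K \<open>0 < \<delta>\<close> unfolding compact_CZ_kernel_def CZ_kernel_def by blast
  then obtain CK where "CZ_kernel K \<delta> CK L S D" ..
  then interpret CZ_kernel K \<delta> CK L S D .
  show ?case
  \<comment> \<open>This constant depends only on n, \<delta> and the kernel constant, so it is
    uniform in I, C, N, \<phi>, x and x'.\<close>
  proof (rule exI[of _ "CK * 2 powr (real CARD('n) + \<delta>)"], intro conjI allI impI, goal_cases)
    case 1
    then show ?case using CK_pos by simp
  next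
    case (2 I C N \<phi> x)
    then have I: "is_cube I" "C > 0" "bump_order_zero I C N \<phi>" "vanishes_outside \<phi> I"
      by simp_all
    show ?case by (rule point_value_size[OF T \<Phi> I]) (use 2 in simp)
  next
    case (3 I C N \<phi> x x')
    then have I: "is_cube I" "C > 0" "bump_order_zero I C N \<phi>" "vanishes_outside \<phi> I"
      by simp_all
    show ?case by (rule point_value_smooth[OF T \<Phi> I]) (use 3 in simp_all)
  qed
qed simp_all

end
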